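(* Let $x^+\in G(x,v)$ be a stochastic difference inclusion on $\mathcal X\subseteq\mathbb R^n$ with random inputs in $\mathcal V\subseteq\mathbb R^m$, satisfying the standing assumptions (A1)–(A4) and the i.i.d. assumption listed in the context, and suppose that $G$ is a convex set-valued map, i.e. its graph $\{(x,v,y): (x,v)\in\mathcal X\times\mathcal V,\ y\in G(x,v)\}$ is convex. Let $X_o,X_u\subseteq\mathcal X$, and let $B:\mathcal X\to\mathbb R_{\ge 0}$ be a concave barrier function candidate with respect to $(X_o,X_u)$ such that for each $x\in\mathcal X\setminus X_u$, $$\sup_{x^+\in G(x,\mathbb E[v])}B(x^+)\le B(x).$$ Then $B$ is a supermartingale barrier function, i.e. for each $x\in\mathcal X\setminus X_u$, $$\mathbb E\Big[\sup_{x^+\in G(x,v)}B(x^+)\Big]\le B(x).$$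
   Context: Setting. $G:\mathcal X\times\mathcal V\rightrightarrows\mathbb R^n$ is a set-valued map with $G(x,v)\subseteq\mathcal X$. Assumptions on $G$: (A1) for each $v\in\mathcal V$, $x\mapsto G(x,v)$ is upper semicontinuous, meaning that for every $x$ and $\epsilon>0$ there is a neighborhood $U(x)$ with $G(y,v)\subseteq G(x,v)+\epsilon\mathbb B$ for all $y\in U(x)\cap\mathcal X$ ($\mathbb B$ the open unit ball); (A2) $G$ is locally bounded: each point of $\mathcal X\times\mathcal V$ has a neighborhood on which all elements of the values of $G$ are bounded in norm by a common constant; (A3) each $G(x,v)$ is nonempty, closed and convex; (A4) $v\mapsto\operatorname{graph}(G(\cdot,v))=\{(x,y)\in\mathcal X\times\mathcal X: y\in G(x,v)\}$ is a measurable set-valued map (preimages $\{v:\operatorname{graph}(G(\cdot,v))\cap O\ne\emptyset\}$ of open sets $O$ are measurable). I.i.d. assumption: $(v_i)_{i\ge0}$ are i.i.d. random vectors on a probability space $(\Omega,\mathcal F,\mathbb P)$ with values in $\mathcal V$ and common distribution $\mu$ on the Borel sets of $\mathcal V$; $v$ denotes a generic random vector with law $\mu$, and its expectation $\mathbb E[v]$ is assumed to exist. A barrier function candidate with respect to $(X_o,X_u)$ is a nonnegative upper semicontinuous function $B:\mathcal X\to\mathbb R_{\ge0}$ such that, for some $\Delta>\delta\ge0$, $B(x)\le\delta$ on $X_o$ and $B(x)\ge\Delta$ on $X_u$. *)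

theory Defs
  imports "HOL-Probability.Probability"
begin

text \<open>
  A set-valued map on \<open>X \<times> V\<close> is a total function \<open>G\<close>; only its values at \<open>x \<in> X\<close>, \<open>v \<in> V\<close>
  are ever constrained. Neighbourhoods are relative to \<open>X\<close>, respectively \<open>X \<times> V\<close>.
\<close>

definition usc_set_map :: "('a::real_normed_vector) set \<Rightarrow> ('a \<Rightarrow> 'b::real_normed_vector set) \<Rightarrow> bool"
  where "usc_set_map X F \<longleftrightarrow>
    (\<forall>x\<in>X. \<forall>\<epsilon>>0. \<exists>U. open U \<and> x \<in> U \<and>
      (\<forall>y\<in>U \<inter> X. F y \<subseteq> {z + \<epsilon> *\<^sub>R b | z b. z \<in> F x \<and> b \<in> ball 0 1}))"

definition locally_bounded_map ::
    "('a::topological_space) set \<Rightarrow> ('b::topological_space) set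
      \<Rightarrow> ('a \<Rightarrow> 'b \<Rightarrow> 'c::real_normed_vector set) \<Rightarrow> bool"
  where "locally_bounded_map X V G \<longleftrightarrow>
    (\<forall>x\<in>X. \<forall>v\<in>V. \<exists>U c. open U \<and> (x, v) \<in> U \<and>
      (\<forall>(y, w) \<in> U \<inter> (X \<times> V). \<forall>z\<in>G y w. norm z \<le> c))"

definition section_graph :: "'a set \<Rightarrow> ('a \<Rightarrow> 'b \<Rightarrow> 'a set) \<Rightarrow> 'b \<Rightarrow> ('a \<times> 'a) set"
  where "section_graph X G v = {(x, y). x \<in> X \<and> y \<in> X \<and> y \<in> G x v}"

definition full_graph :: "'a set \<Rightarrow> 'b set \<Rightarrow> ('a \<Rightarrow> 'b \<Rightarrow> 'a set) \<Rightarrow> ('a \<times> 'b \<times> 'a) set"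
  where "full_graph X V G = {(x, v, y). x \<in> X \<and> v \<in> V \<and> y \<in> G x v}"

abbreviation borel_on :: "('b::topological_space) set \<Rightarrow> 'b measure"
  where "borel_on V \<equiv> restrict_space borel V"

definition stochastic_inclusion ::
    "(real ^ 'n) set \<Rightarrow> (real ^ 'm) set \<Rightarrow> (real ^ 'n \<Rightarrow> real ^ 'm \<Rightarrow> (real ^ 'n) set) \<Rightarrow> bool"
  where "stochastic_inclusion X V G \<longleftrightarrow>
    (\<forall>x\<in>X. \<forall>v\<in>V. G x v \<subseteq> X) \<and>
    (\<forall>v\<in>V. usc_set_map X (\<lambda>x. G x v)) \<and>
    locally_bounded_map X V G \<and>
    (\<forall>x\<in>X. \<forall>v\<in>V. G x v \<noteq> {} \<and> closed (G x v) \<and> convex (G x v)) \<and>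
    (\<forall>A. open A \<longrightarrow> {v\<in>V. section_graph X G v \<inter> A \<noteq> {}} \<in> sets (borel_on V))"

definition iid_inputs ::
    "'w measure \<Rightarrow> (real ^ 'm) set \<Rightarrow> (nat \<Rightarrow> 'w \<Rightarrow> real ^ 'm) \<Rightarrow> (real ^ 'm) measure \<Rightarrow> bool"
  where "iid_inputs P V v \<mu> \<longleftrightarrow>
    prob_space P \<and>
    prob_space.indep_vars P (\<lambda>_. borel_on V) v UNIV \<and>
    (\<forall>i. distr P (borel_on V) (v i) = \<mu>)"

definition usc_on :: "('a::topological_space) set \<Rightarrow> ('a \<Rightarrow> real) \<Rightarrow> bool"
  where "usc_on X B \<longleftrightarrow> (\<forall>x\<in>X. \<forall>c>B x. eventually (\<lambda>y. B y < c) (at x within X))"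

definition barrier_candidate ::
    "(real ^ 'n) set \<Rightarrow> (real ^ 'n) set \<Rightarrow> (real ^ 'n) set \<Rightarrow> (real ^ 'n \<Rightarrow> real) \<Rightarrow> bool"
  where "barrier_candidate X Xo Xu B \<longleftrightarrow>
    (\<forall>x\<in>X. 0 \<le> B x) \<and> usc_on X B \<and>
    (\<exists>\<Delta> \<delta>. \<Delta> > \<delta> \<and> \<delta> \<ge> 0 \<and> (\<forall>x\<in>Xo. B x \<le> \<delta>) \<and> (\<forall>x\<in>Xu. B x \<ge> \<Delta>))"

text \<open>
  Since \<open>B\<close> is nonnegative on \<open>X\<close>, suprema and expectations of its values are taken in
  \<open>[0, \<infinity>]\<close>, where they always exist; in particular an unbounded supremum or a divergent
  expectation is \<open>\<infinity>\<close> rather than a default real number.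
\<close>

definition sup_next :: "('a \<Rightarrow> 'b \<Rightarrow> 'a set) \<Rightarrow> ('a \<Rightarrow> real) \<Rightarrow> 'a \<Rightarrow> 'b \<Rightarrow> ennreal"
  where "sup_next G B x v = (SUP y\<in>G x v. ennreal (B y))"

text \<open>
  The nonnegative integral of a non-measurable function would only be a lower integral, so
  measurability of the supremum is part of what the expectation inequality asserts.
\<close>

definition supermartingale_barrier ::
    "'w measure \<Rightarrow> ('w \<Rightarrow> real ^ 'm) \<Rightarrow> (real ^ 'n \<Rightarrow> real ^ 'm \<Rightarrow> (real ^ 'n) set) \<Rightarrow>
     (real ^ 'n) set \<Rightarrow> (real ^ 'n) set \<Rightarrow> (real ^ 'n) set \<Rightarrow> (real ^ 'n \<Rightarrow> real) \<Rightarrow> bool"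
  where "supermartingale_barrier P w G X Xo Xu B \<longleftrightarrow>
    barrier_candidate X Xo Xu B \<and>
    (\<forall>x\<in>X - Xu.
      (\<lambda>\<omega>. sup_next G B x (w \<omega>)) \<in> borel_measurable P \<and>
      (\<integral>\<^sup>+\<omega>. sup_next G B x (w \<omega>) \<partial>P) \<le> ennreal (B x))"

end

theory Submission
  imports Defs
begin

text \<open>
  Fix \<open>x\<close> and put \<open>h v = sup {B y | y \<in> G x v}\<close>. Convexity of the graph and concavity of \<open>B\<close> make the
  strict hypograph of \<open>h\<close> convex. The mean of an integrable random vector lies in every convex
  set containing its values, so applying this to \<open>(w, min (h w) N - \<epsilon>)\<close> gives Jensen's
  inequality for the truncations of \<open>h\<close>, and \<open>\<epsilon> \<rightarrow> 0\<close>, \<open>N \<rightarrow> \<infinity>\<close> finish the estimate. A concave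
  function need not be Borel at the boundary of its domain, so measurability of \<open>h\<close> is derived
  from that of the graph map: \<open>G x v\<close> meets a relatively closed set \<open>K\<close> iff the graph of
  \<open>G(\<cdot>, v)\<close> meets every neighbourhood of \<open>{x} \<times> K\<close>.
\<close>

section \<open>Means of random vectors with values in a convex set\<close>

text \<open>
  If the mean were outside \<open>C\<close>, the random vector would almost surely lie in a hyperplane
  separating the mean from \<open>C\<close>, which reduces the dimension.
\<close>

lemma (in prob_space) expectation_in_convex:
  fixes Z :: "'a \<Rightarrow> 'b::euclidean_space"
  assumes "convex C" and "integrable M Z" and "AE \<omega> in M. Z \<omega> \<in> C"
  shows "expectation Z \<in> C"
  using assms(1,3)
proof (induction "nat (aff_dim C + 1)" arbitrary: C rule: less_induct)
  case less
  let ?m = "expectation Z"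
  show ?case
  proof (rule ccontr)
    assume notin: "?m \<notin> C"
    have "C \<noteq> {}"
    proof
      assume "C = {}"
      with less.prems(2) have "AE \<omega> in M. False" by simp
      then show False by simp
    qed
    \<comment> \<open>The normal \<open>a\<close> can be chosen parallel to the affine hull of
      \<open>insert ?m C\<close>. This rules out a hyperplane that contains the whole hull, and so
      makes the dimension drop below.\<close>
    then obtain a b where a: "?m + a \<in> affine hull (insert ?m C)" "a \<noteq> 0"
        and mb: "a \<bullet> ?m \<le> b" and Cb: "\<And>x. x \<in> C \<Longrightarrow> a \<bullet> x \<ge> b"
      using separating_hyperplane_set_point_inaff[OF less.prems(1) _ notin] by metis
    have int: "integrable M (\<lambda>\<omega>. a \<bullet> Z \<omega> - b)"
      using assms(2) by simp
    have val: "expectation (\<lambda>\<omega>. a \<bullet> Z \<omega> - b) = a \<bullet> ?m - b"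
      using assms(2) by (simp add: prob_space)
    have nonneg: "AE \<omega> in M. 0 \<le> a \<bullet> Z \<omega> - b"
      using less.prems(2) by eventually_elim (use Cb in fastforce)
    \<comment> \<open>The variable \<open>a \<bullet> Z \<omega> - b\<close> is almost surely
      nonnegative while its mean is at most 0. Hence the mean is 0 and the variable vanishes almost
      surely.\<close>
    have am: "a \<bullet> ?m = b"
      using integral_nonneg_AE[OF nonneg] val mb by simp
    have AE_eq: "AE \<omega> in M. a \<bullet> Z \<omega> - b = 0"
      using integral_nonneg_eq_0_iff_AE[OF int nonneg] val am by simp
    define D where "D = C \<inter> {x. a \<bullet> x = b}"
    have "convex D"
      unfolding D_def by (intro convex_Int less.prems convex_hyperplane)
    moreover have "AE \<omega> in M. Z \<omega> \<in> D"
      using less.prems(2) AE_eq by eventually_elim (auto simp: D_def)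
    \<comment> \<open>With equal dimensions the hulls of \<open>D\<close> and \<open>C\<close>
      agree, so the hyperplane contains \<open>C\<close>, \<open>?m\<close> and their hull. But
      \<open>?m + a\<close> lies in that hull, and its inner product with \<open>a\<close> exceeds
      \<open>b\<close> by the square of the norm of \<open>a\<close>.\<close>
    moreover have "aff_dim D < aff_dim C"
    proof (rule ccontr)
      assume "\<not> aff_dim D < aff_dim C"
      moreover have "affine hull D \<subseteq> affine hull C"
        unfolding D_def by (intro hull_mono) auto
      ultimately have "affine hull D = affine hull C"
        by (metis D_def Int_lower1 aff_dim_eq_full_gen antisym aff_dim_subset linorder_not_less)
      moreover have "affine hull D \<subseteq> {x. a \<bullet> x = b}"
        by (rule hull_minimal) (auto simp: D_def affine_hyperplane)
      ultimately have "insert ?m C \<subseteq> {x. a \<bullet> x = b}"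
        using hull_subset[of C affine] am by auto
      then have "affine hull (insert ?m C) \<subseteq> {x. a \<bullet> x = b}"
        by (intro hull_minimal affine_hyperplane)
      with a am show False
        by (auto simp: inner_add_right)
    qed
    \<comment> \<open>The shift by 1 matters because the empty set has \<open>aff_dim\<close> equal
      to -1, which \<open>nat\<close> alone would identify with 0.\<close>
    moreover have "nat (aff_dim D + 1) < nat (aff_dim C + 1)"
      using calculation(3) aff_dim_geq[of D] by linarith
    ultimately have "?m \<in> D"
      using less.hyps by blast
    with notin show False
      by (simp add: D_def)
  qed
qed

section \<open>Measurability of the supremum in the random input\<close>

text \<open>Upper semicontinuity moves graph points near \<open>{x} \<times> K\<close> to points of
  \<open>F x\<close> near \<open>K\<close>, so the two sets are at distance zero; compactness of
  \<open>F x\<close> turns this into a common point. The right side tests the graph only against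
  open sets, as the measurability assumption requires.\<close>

lemma meets_relatively_closed_iff:
  fixes F :: "'a::euclidean_space \<Rightarrow> 'a set"
  assumes usc: "usc_set_map X F" and x: "x \<in> X"
    and bdd: "bounded (F x)" and clo: "closed (F x)" and FX: "F x \<subseteq> X"
    and Q: "closedin (top_of_set X) K"
  shows "F x \<inter> K \<noteq> {} \<longleftrightarrow>
    (\<forall>k. \<exists>x' y'. x' \<in> X \<and> y' \<in> X \<and> y' \<in> F x' \<and> x' \<in> ball x (1 / Suc k) \<and>
        y' \<in> (\<Union>z\<in>K. ball z (1 / Suc k)))" (is "_ \<longleftrightarrow> (\<forall>k. ?P k)")
proof
  assume "F x \<inter> K \<noteq> {}"
  then obtain y where "y \<in> F x" "y \<in> K" by blast
  then have "?P k" for k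
    using x FX by - (rule exI[of _ x], rule exI[of _ y], auto intro!: bexI[of _ y])
  then show "\<forall>k. ?P k" ..
next
  assume P: "\<forall>k. ?P k"
  have near: "\<exists>z\<in>F x. \<exists>z'\<in>K. dist z z' < \<epsilon>" if "\<epsilon> > 0" for \<epsilon>
  proof -
    obtain U where U: "open U" "x \<in> U"
        "\<And>y. y \<in> U \<inter> X \<Longrightarrow> F y \<subseteq> {z + (\<epsilon>/2) *\<^sub>R b | z b. z \<in> F x \<and> b \<in> ball 0 1}"
      using usc x \<open>\<epsilon> > 0\<close> unfolding usc_set_map_def by (meson half_gt_zero)
    obtain d where d: "d > 0" "ball x d \<subseteq> U"
      using U openE by blast
    \<comment> \<open>The bound \<open>d\<close> keeps \<open>x'\<close> inside \<open>U\<close>.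
      One \<open>\<epsilon>/2\<close> is spent between \<open>y'\<close> and \<open>K\<close>, the
      other between \<open>y'\<close> and \<open>F x\<close>.\<close>
    obtain k where k: "1 / Suc k < min d (\<epsilon>/2)"
      using nat_approx_posE[of "min d (\<epsilon>/2)"] d \<open>\<epsilon> > 0\<close> by auto
    from P obtain x' y' z' where *: "x' \<in> X" "y' \<in> F x'" "x' \<in> ball x (1 / Suc k)"
        "z' \<in> K" "y' \<in> ball z' (1 / Suc k)"
      by blast
    then have "x' \<in> U \<inter> X" using d k by auto
    with U(3) *(2) obtain z b where z: "z \<in> F x" "b \<in> ball 0 1" "y' = z + (\<epsilon>/2) *\<^sub>R b"
      by blast
    have "dist z y' = (\<epsilon>/2) * norm b"
      using z(3) \<open>\<epsilon> > 0\<close> by (simp add: dist_norm)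
    also have "\<dots> < \<epsilon>/2"
      using z(2) \<open>\<epsilon> > 0\<close> by simp
    finally have "dist z z' < \<epsilon>"
      using *(5) k dist_triangle[of z z' y'] by (auto simp: dist_commute)
    with z(1) *(4) show ?thesis by blast
  qed
  have "compact (F x)"
    using bdd clo by (simp add: compact_eq_bounded_closed)
  moreover have "K \<noteq> {}" "F x \<noteq> {}"
    using near[of 1] by auto
  ultimately obtain z where z: "z \<in> F x" "z \<in> closure K"
    using separate_compact_closed[of "F x" "closure K"] near closure_subset[of K]
    by (metis closed_closure disjoint_iff not_le subsetD)
  \<comment> \<open>\<open>K\<close> is closed only relative to \<open>X\<close>, so a point of its
    closure returns to \<open>K\<close> because \<open>F x\<close> lies in \<open>X\<close>.\<close>
  with FX have "z \<in> K"
    using Q by (auto simp: closedin_limpt closure_def)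
  with z show "F x \<inter> K \<noteq> {}" by blast
qed

lemma usc_on_superlevel_closedin:
  assumes "usc_on X B"
  shows "closedin (top_of_set X) {y\<in>X. c \<le> B y}"
proof -
  have "y \<notin> {y. y islimpt {y\<in>X. c \<le> B y}}" if "y \<in> X" "B y < c" for y
  proof -
    have "eventually (\<lambda>z. B z < c) (at y within X)"
      using assms that unfolding usc_on_def by blast
    then obtain U where "open U" "y \<in> U" "\<forall>z\<in>U. z \<noteq> y \<longrightarrow> z \<in> X \<longrightarrow> B z < c"
      unfolding eventually_at_topological by blast
    then show ?thesis
      unfolding islimpt_def by force
  qed
  then show ?thesis
    unfolding closedin_limpt by force
qed

lemma stochastic_inclusion_bounded:
  assumes "stochastic_inclusion X V G" "x \<in> X" "u \<in> V"
  shows "bounded (G x u)"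
proof -
  have "locally_bounded_map X V G"
    using assms(1) by (simp add: stochastic_inclusion_def)
  from bspec[OF bspec[OF this[unfolded locally_bounded_map_def] assms(2)] assms(3)]
  obtain U c where U: "(x, u) \<in> U" "\<forall>(y, w) \<in> U \<inter> (X \<times> V). \<forall>z\<in>G y w. norm z \<le> c"
    by auto
  have "(x, u) \<in> U \<inter> (X \<times> V)"
    using U(1) assms(2,3) by simp
  from bspec[OF U(2) this] show ?thesis
    unfolding bounded_iff by auto
qed

lemma measurable_meets_relatively_closed:
  assumes G: "stochastic_inclusion X V G" and x: "x \<in> X"
    and K: "closedin (top_of_set X) K"
  shows "{u\<in>V. G x u \<inter> K \<noteq> {}} \<in> sets (borel_on V)"
proof -
  define A where "A k = ball x (1 / Suc k) \<times> (\<Union>z\<in>K. ball z (1 / Suc k))" for k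
  have meets: "section_graph X G u \<inter> (R \<times> S) \<noteq> {} \<longleftrightarrow>
      (\<exists>x' y'. x' \<in> X \<and> y' \<in> X \<and> y' \<in> G x' u \<and> x' \<in> R \<and> y' \<in> S)" for u R S
    by (auto simp: section_graph_def)
  have "G x u \<inter> K \<noteq> {} \<longleftrightarrow> (\<forall>k. section_graph X G u \<inter> A k \<noteq> {})" if "u \<in> V" for u
  proof -
    have "G x u \<inter> K \<noteq> {} \<longleftrightarrow>
      (\<forall>k. \<exists>x' y'. x' \<in> X \<and> y' \<in> X \<and> y' \<in> G x' u \<and> x' \<in> ball x (1 / Suc k) \<and>
        y' \<in> (\<Union>z\<in>K. ball z (1 / Suc k)))"
    proof (rule meets_relatively_closed_iff)
      show "usc_set_map X (\<lambda>x. G x u)" "closed (G x u)" "G x u \<subseteq> X"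
        using G x that by (simp_all add: stochastic_inclusion_def)
    qed (use stochastic_inclusion_bounded[OF G x that] x K in auto)
    also have "\<dots> \<longleftrightarrow> (\<forall>k. section_graph X G u \<inter> A k \<noteq> {})"
      by (simp only: A_def meets)
    finally show ?thesis .
  qed
  then have "{u\<in>V. G x u \<inter> K \<noteq> {}} = (\<Inter>k. {u\<in>V. section_graph X G u \<inter> A k \<noteq> {}})"
    by (intro set_eqI) (simp cong: conj_cong)
  also have "\<dots> \<in> sets (borel_on V)"
  proof (rule sets.countable_INT)
    have "open (A k)" for k
      unfolding A_def by (intro open_Times open_ball open_UN ballI)
    then show "range (\<lambda>k. {u\<in>V. section_graph X G u \<inter> A k \<noteq> {}}) \<subseteq> sets (borel_on V)"
      using G unfolding stochastic_inclusion_def by blast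
  qed auto
  finally show ?thesis .
qed

lemma measurable_sup_next:
  assumes G: "stochastic_inclusion X V G" and x: "x \<in> X" and B: "usc_on X B"
  shows "sup_next G B x \<in> borel_measurable (borel_on V)"
proof (rule borel_measurableI_greater)
  fix c :: ennreal
  define S where "S q = {u\<in>V. G x u \<inter> {y\<in>X. real_of_rat q \<le> B y} \<noteq> {}}" for q
  \<comment> \<open>A rational between \<open>c\<close> and \<open>B y\<close> replaces the strict
    superlevel set by countably many weak ones, which are relatively closed by upper semicontinuity
    of \<open>B\<close>.\<close>
  have "{u \<in> space (borel_on V). c < sup_next G B x u} = (\<Union>q\<in>{q. c < ennreal (real_of_rat q)}. S q)"
  proof (intro equalityI subsetI)
    fix u assume "u \<in> {u \<in> space (borel_on V). c < sup_next G B x u}"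
    then obtain y where u: "u \<in> V" and y: "y \<in> G x u" "c < ennreal (B y)"
      by (auto simp: sup_next_def less_SUP_iff space_restrict_space)
    then have "y \<in> X"
      using G x by (auto simp: stochastic_inclusion_def)
    from ennreal_rat_dense[OF y(2)] obtain q
      where q: "c < ennreal (real_of_rat q)" "ennreal (real_of_rat q) < ennreal (B y)" by blast
    then have "real_of_rat q \<le> B y"
      by (metis ennreal_leI linorder_le_cases not_le)
    with q u y \<open>y \<in> X\<close> show "u \<in> (\<Union>q\<in>{q. c < ennreal (real_of_rat q)}. S q)"
      by (auto simp: S_def)
  next
    fix u assume "u \<in> (\<Union>q\<in>{q. c < ennreal (real_of_rat q)}. S q)"
    then obtain q y where "c < ennreal (real_of_rat q)" "u \<in> V" "y \<in> G x u" "real_of_rat q \<le> B y"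
      by (auto simp: S_def)
    then show "u \<in> {u \<in> space (borel_on V). c < sup_next G B x u}"
      by (auto simp: sup_next_def less_SUP_iff space_restrict_space
          intro!: bexI[of _ y] elim: order_less_le_trans intro: ennreal_leI)
  qed
  also have "\<dots> \<in> sets (borel_on V)"
    unfolding S_def
    by (intro sets.countable_UN'' measurable_meets_relatively_closed[OF G x]
        usc_on_superlevel_closedin B) auto
  finally show "{u \<in> space (borel_on V). c < sup_next G B x u} \<in> sets (borel_on V)" .
qed

section \<open>Jensen's inequality for the supremum\<close>

text \<open>Being strictly below the supremum means having a witness \<open>y\<close>, whether or
  not the supremum is attained. Witnesses combine convexly in the graph because both points share
  the state \<open>x\<close>.\<close>

lemma convex_hypograph_sup_next:
  fixes G :: "'a::real_vector \<Rightarrow> 'b::real_vector \<Rightarrow> 'a set"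
  assumes G: "convex (full_graph X V G)" and B: "concave_on X B" and x: "x \<in> X"
    and GX: "\<And>u. u \<in> V \<Longrightarrow> G x u \<subseteq> X"
  shows "convex {(u, t). u \<in> V \<and> (\<exists>y\<in>G x u. t < B y)}"
proof (rule convexI, clarsimp)
  fix u1 t1 u2 t2 y1 y2 and a b :: real
  assume ab: "0 \<le> a" "0 \<le> b" "a + b = 1"
    and 1: "u1 \<in> V" "y1 \<in> G x u1" "t1 < B y1" and 2: "u2 \<in> V" "y2 \<in> G x u2" "t2 < B y2"
  have "a *\<^sub>R (x, u1, y1) + b *\<^sub>R (x, u2, y2) \<in> full_graph X V G"
    using ab 1 2 x by (intro convexD[OF G]) (auto simp: full_graph_def)
  moreover have "a *\<^sub>R x + b *\<^sub>R x = x"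
    using ab by (metis scaleR_add_left scaleR_one)
  ultimately have *: "a *\<^sub>R u1 + b *\<^sub>R u2 \<in> V" "a *\<^sub>R y1 + b *\<^sub>R y2 \<in> G x (a *\<^sub>R u1 + b *\<^sub>R u2)"
    by (auto simp: full_graph_def)
  have y: "y1 \<in> X" "y2 \<in> X"
    using 1 2 GX by auto
  \<comment> \<open>Strictness comes from a term with positive weight: the first one, or the second
    if \<open>a = 0\<close>.\<close>
  have "a * t1 + b * t2 < a * B y1 + b * B y2"
    using ab 1(3) 2(3)
    by (cases "a = 0") (auto intro!: add_less_le_mono mult_strict_left_mono mult_left_mono)
  also have "\<dots> \<le> B (a *\<^sub>R y1 + b *\<^sub>R y2)"
    using B y ab unfolding concave_on_iff by blast
  finally show "a *\<^sub>R u1 + b *\<^sub>R u2 \<in> V \<and>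
      (\<exists>y\<in>G x (a *\<^sub>R u1 + b *\<^sub>R u2). a * t1 + b * t2 < B y)"
    using * by blast
qed

text \<open>Monotone convergence. It allows Jensen's inequality to be proved for bounded functions,
  before the supremum is known to be integrable.\<close>

lemma nn_integral_le_if_truncations_le:
  fixes f :: "'a \<Rightarrow> ennreal"
  assumes [measurable]: "f \<in> borel_measurable M"
    and le: "\<And>N::nat. (\<integral>\<^sup>+\<omega>. min (f \<omega>) (of_nat N) \<partial>M) \<le> c"
  shows "(\<integral>\<^sup>+\<omega>. f \<omega> \<partial>M) \<le> c"
proof -
  have "f \<omega> = (SUP N::nat. min (f \<omega>) (of_nat N))" for \<omega>
    by (simp add: inf_min[symmetric] inf_SUP[symmetric] ennreal_SUP_of_nat_eq_top)
  then have "(\<integral>\<^sup>+\<omega>. f \<omega> \<partial>M) = (\<integral>\<^sup>+\<omega>. (SUP N::nat. min (f \<omega>) (of_nat N)) \<partial>M)"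
    by simp
  also have "\<dots> = (SUP N::nat. \<integral>\<^sup>+\<omega>. min (f \<omega>) (of_nat N) \<partial>M)"
    by (intro nn_integral_monotone_convergence_SUP)
      (auto simp: incseq_def le_fun_def min.coboundedI2)
  also have "\<dots> \<le> c"
    using le by (intro SUP_least)
  finally show ?thesis .
qed

lemma has_bochner_integral_Pair:
  fixes f :: "'a \<Rightarrow> 'b::{second_countable_topology, banach}"
    and g :: "'a \<Rightarrow> 'c::{second_countable_topology, banach}"
  assumes "has_bochner_integral M f a" and "has_bochner_integral M g b"
  shows "has_bochner_integral M (\<lambda>\<omega>. (f \<omega>, g \<omega>)) (a, b)"
proof -
  have "bounded_linear (\<lambda>x::'b. (x, 0::'c))" "bounded_linear (\<lambda>y::'c. (0::'b, y))"
    by (intro bounded_linear_Pair bounded_linear_ident bounded_linear_zero)+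
  from has_bochner_integral_add[OF has_bochner_integral_bounded_linear[OF this(1) assms(1)]
      has_bochner_integral_bounded_linear[OF this(2) assms(2)]]
  show ?thesis by simp
qed

lemma (in prob_space) nn_integral_sup_next_le:
  fixes G :: "'b::euclidean_space \<Rightarrow> 'c::euclidean_space \<Rightarrow> 'b set"
  assumes conv: "convex (full_graph X V G)" and B: "concave_on X B" and x: "x \<in> X"
    and G: "\<And>u. u \<in> V \<Longrightarrow> G x u \<subseteq> X" "\<And>u. u \<in> V \<Longrightarrow> G x u \<noteq> {}"
    and B0: "\<And>y. y \<in> X \<Longrightarrow> 0 \<le> B y"
    and w: "integrable M w" "\<And>\<omega>. \<omega> \<in> space M \<Longrightarrow> w \<omega> \<in> V"
    and meas [measurable]: "(\<lambda>\<omega>. sup_next G B x (w \<omega>)) \<in> borel_measurable M"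
  shows "(\<integral>\<^sup>+\<omega>. sup_next G B x (w \<omega>) \<partial>M) \<le> sup_next G B x (expectation w)"
proof (rule nn_integral_le_if_truncations_le[OF meas])
  fix N :: nat
  \<comment> \<open>The truncation is finite, so \<open>enn2real\<close> loses nothing.\<close>
  define g where "g \<omega> = enn2real (min (sup_next G B x (w \<omega>)) (of_nat N))" for \<omega>
  have g_eq: "ennreal (g \<omega>) = min (sup_next G B x (w \<omega>)) (of_nat N)" for \<omega>
    unfolding g_def by (rule ennreal_enn2real) (simp add: min_less_iff_disj ennreal_of_nat_eq_real_of_nat)
  have g_le: "g \<omega> \<le> N" for \<omega>
    using g_eq[of \<omega>] by (metis ennreal_of_nat_eq_real_of_nat ennreal_le_iff min.cobounded2 of_nat_0_le_iff)
  have g0: "0 \<le> g \<omega>" for \<omega>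
    by (simp add: g_def)
  have [measurable]: "g \<in> borel_measurable M"
    unfolding g_def by measurable
  have int_g: "integrable M g"
    by (rule integrable_const_bound[of _ "real N"]) (use g_le g0 in auto)
  have "ennreal (expectation g) \<le> sup_next G B x (expectation w) + ennreal \<epsilon>" if "\<epsilon> > 0" for \<epsilon>
  proof -
    have Pair: "has_bochner_integral M (\<lambda>\<omega>. (w \<omega>, g \<omega> - \<epsilon>)) (expectation w, expectation g - \<epsilon>)"
      using has_bochner_integral_Pair[OF has_bochner_integral_integrable[OF w(1)],
          of "\<lambda>\<omega>. g \<omega> - \<epsilon>" "expectation g - \<epsilon>"] int_g
      by (simp add: has_bochner_integral_iff prob_space)
    let ?C = "{(u, t). u \<in> V \<and> (\<exists>y\<in>G x u. t < B y)}"
    have "expectation (\<lambda>\<omega>. (w \<omega>, g \<omega> - \<epsilon>)) \<in> ?C"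
    proof (rule expectation_in_convex)
      show "convex ?C"
        using conv B x G(1) by (rule convex_hypograph_sup_next)
      show "integrable M (\<lambda>\<omega>. (w \<omega>, g \<omega> - \<epsilon>))"
        using Pair by (simp add: has_bochner_integral_iff)
      show "AE \<omega> in M. (w \<omega>, g \<omega> - \<epsilon>) \<in> ?C"
      proof (rule AE_I2)
        fix \<omega> assume "\<omega> \<in> space M"
        then have V: "w \<omega> \<in> V" by (rule w)
        have "\<exists>y\<in>G x (w \<omega>). g \<omega> - \<epsilon> < B y"
        \<comment> \<open>If \<open>g \<omega> = 0\<close>, then \<open>ennreal\<close> would clip
          the negative number \<open>g \<omega> - \<epsilon>\<close> to 0 and no strict inequality
          would remain. There any point of the nonempty value serves, as \<open>B\<close> is
          nonnegative.\<close>
        proof (cases "g \<omega> = 0")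
          case True
          from G(2)[OF V] obtain y where "y \<in> G x (w \<omega>)" by blast
          moreover from this have "0 \<le> B y"
            using G(1)[OF V] B0 by blast
          ultimately show ?thesis
            using True that by (intro bexI[of _ y]) auto
        next
          case False
          with that g0[of \<omega>] have "ennreal (g \<omega> - \<epsilon>) < ennreal (g \<omega>)"
            by (intro ennreal_lessI) auto
          also have "\<dots> \<le> sup_next G B x (w \<omega>)"
            by (simp add: g_eq)
          finally obtain y where "y \<in> G x (w \<omega>)" "ennreal (g \<omega> - \<epsilon>) < ennreal (B y)"
            by (auto simp: sup_next_def less_SUP_iff)
          then show ?thesis
            by (metis ennreal_leI not_le)
        qed
        with V show "(w \<omega>, g \<omega> - \<epsilon>) \<in> ?C" by simp
      qed
    qed
    moreover have "expectation (\<lambda>\<omega>. (w \<omega>, g \<omega> - \<epsilon>)) = (expectation w, expectation g - \<epsilon>)"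
      using Pair by (simp add: has_bochner_integral_iff)
    \<comment> \<open>Membership in \<open>?C\<close> also shows that the mean input lies in
      \<open>V\<close>.\<close>
    ultimately obtain y where y: "expectation w \<in> V" "y \<in> G x (expectation w)" "expectation g - \<epsilon> < B y"
      by auto
    have "ennreal (expectation g) \<le> ennreal (B y + \<epsilon>)"
      using y by (intro ennreal_leI) simp
    also have "\<dots> = ennreal (B y) + ennreal \<epsilon>"
      using B0 G(1) y that by (intro ennreal_plus) auto
    also have "\<dots> \<le> sup_next G B x (expectation w) + ennreal \<epsilon>"
      unfolding sup_next_def using y by (intro add_right_mono SUP_upper)
    finally show ?thesis .
  qed
  then have "ennreal (expectation g) \<le> sup_next G B x (expectation w)"
    by (rule ennreal_le_epsilon)
  moreover have "(\<integral>\<^sup>+\<omega>. min (sup_next G B x (w \<omega>)) (of_nat N) \<partial>M) = ennreal (expectation g)"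
    unfolding g_eq[symmetric] using int_g g0 by (intro nn_integral_eq_integral) auto
  ultimately show "(\<integral>\<^sup>+\<omega>. min (sup_next G B x (w \<omega>)) (of_nat N) \<partial>M) \<le> sup_next G B x (expectation w)"
    by simp
qed

theorem lemma30:
  fixes X Xo Xu :: "(real ^ 'n) set"
    and V :: "(real ^ 'm) set"
    and G :: "real ^ 'n \<Rightarrow> real ^ 'm \<Rightarrow> (real ^ 'n) set"
    and B :: "real ^ 'n \<Rightarrow> real"
    and P :: "'w measure"
    and v :: "nat \<Rightarrow> 'w \<Rightarrow> real ^ 'm"
    and \<mu> :: "(real ^ 'm) measure"
    and w :: "'w \<Rightarrow> real ^ 'm"
  assumes "stochastic_inclusion X V G"
    and "iid_inputs P V v \<mu>"
    and "w \<in> P \<rightarrow>\<^sub>M borel_on V" and "distr P (borel_on V) w = \<mu>"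
    and "integrable P w"
    and "convex (full_graph X V G)"
    and "Xo \<subseteq> X" and "Xu \<subseteq> X"
    and "barrier_candidate X Xo Xu B"
    and "concave_on X B"
    and "\<forall>x\<in>X - Xu. sup_next G B x (prob_space.expectation P w) \<le> ennreal (B x)"
  shows "supermartingale_barrier P w G X Xo Xu B"
  unfolding supermartingale_barrier_def
proof (intro conjI ballI)
  interpret prob_space P
    using assms(2) by (simp add: iid_inputs_def)
  fix x assume x: "x \<in> X - Xu"
  have B: "usc_on X B" "\<And>y. y \<in> X \<Longrightarrow> 0 \<le> B y"
    using assms(9) by (auto simp: barrier_candidate_def)
  show meas: "(\<lambda>\<omega>. sup_next G B x (w \<omega>)) \<in> borel_measurable P"
    using measurable_compose[OF assms(3) measurable_sup_next[OF assms(1) _ B(1)]] x by simp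
  \<comment> \<open>The space of \<open>borel_on V\<close> is \<open>V\<close> itself, so
    measurability of \<open>w\<close> places every value in \<open>V\<close>, with no exceptional
    null set.\<close>
  have "w \<omega> \<in> V" if "\<omega> \<in> space P" for \<omega>
    using measurable_space[OF assms(3) that] by (simp add: space_restrict_space)
  then have "(\<integral>\<^sup>+\<omega>. sup_next G B x (w \<omega>) \<partial>P) \<le> sup_next G B x (expectation w)"
    using assms(1) x B(2) meas
    by (intro nn_integral_sup_next_le[OF assms(6) assms(10)] assms(5))
      (auto simp: stochastic_inclusion_def)
  also have "\<dots> \<le> ennreal (B x)"
    using assms(11) x by blast
  finally show "(\<integral>\<^sup>+\<omega>. sup_next G B x (w \<omega>) \<partial>P) \<le> ennreal (B x)" .
qed (fact assms(9))

end
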